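(* Let $G$ be a strong bicentral $2$-tree on $n\ge 4$ vertices with tail set $\{2,3\}$ and maximum degree $\Delta$, and let $x$ be the number of tail vertices of degree $3$. Then the following are equivalent: (i) $x=0$; (ii) $\Delta=n-1$; (iii) $G\cong B_{n-2}$. Consequently, the triangular book graph $B_{n-2}$ is the unique strong bicentral $2$-tree with degree sequence $(n-1,n-1,2^{(n-2)})$.
   Context: A $2$-tree is a graph obtained from the triangle $K_3$ by repeatedly adding a new vertex adjacent to both endpoints of an existing edge. For $r\in\{1,2,3\}$ and an integer $\Delta\ge 2$, a $2$-tree on $n$ vertices is $r$-central with maximum degree $\Delta$ if $\Delta$ is its maximum degree and exactly $r$ vertices have degree $\Delta$; these $r$ vertices form the core and the other $n-r$ vertices form the tail. It is strong if the core induces $K_r$. It has tail set $\{2,3\}$ if every tail vertex has degree $2$ or $3$. "Bicentral" means $2$-central. The triangular book graph $B_k$ consists of an edge $ab$ together with $k$ further vertices, each adjacent exactly to $a$ and $b$. The notation $2^{(k)}$ means $k$ entries equal to $2$. *)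

theory Defs
  imports "Graph_Theory.Graph_Theory" "HOL-Library.Multiset"
begin

text \<open>
  A finite simple graph is a symmetric, loop-free, finite pair digraph (locale \<^locale>\<open>pair_graph\<close>):
  an edge \<open>ab\<close> is the pair of arcs \<open>(a, b)\<close>, \<open>(b, a)\<close>.  The degree of a vertex is therefore its
  out-degree.
\<close>

abbreviation deg :: "'a pair_pre_digraph \<Rightarrow> 'a \<Rightarrow> nat" where
  "deg G v \<equiv> out_degree (with_proj G) v"

definition max_degree :: "'a pair_pre_digraph \<Rightarrow> nat" where
  "max_degree G = Max (deg G ` pverts G)"

definition degree_sequence :: "'a pair_pre_digraph \<Rightarrow> nat list" where
  "degree_sequence G = rev (sorted_list_of_multiset (image_mset (deg G) (mset_set (pverts G))))"

definition isomorphic :: "'a pair_pre_digraph \<Rightarrow> 'b pair_pre_digraph \<Rightarrow> bool" where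
  "isomorphic G H \<longleftrightarrow> digraph_iso (with_proj G) (with_proj H)"

inductive two_tree :: "'a pair_pre_digraph \<Rightarrow> bool" where
  triangle: "complete_digraph 3 (with_proj G) \<Longrightarrow> two_tree G"
| add_vertex: "\<lbrakk>two_tree G; (a, b) \<in> parcs G; v \<notin> pverts G\<rbrakk> \<Longrightarrow>
    two_tree \<lparr>pverts = insert v (pverts G), parcs = parcs G \<union> {(v, a), (a, v), (v, b), (b, v)}\<rparr>"

definition core :: "'a pair_pre_digraph \<Rightarrow> 'a set" where
  "core G = {v \<in> pverts G. deg G v = max_degree G}"

definition tail_verts :: "'a pair_pre_digraph \<Rightarrow> 'a set" where
  "tail_verts G = pverts G - core G"

definition central_two_tree :: "nat \<Rightarrow> nat \<Rightarrow> 'a pair_pre_digraph \<Rightarrow> bool" where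
  "central_two_tree r \<Delta> G \<longleftrightarrow>
     r \<in> {1, 2, 3} \<and> \<Delta> \<ge> 2 \<and> two_tree G \<and> max_degree G = \<Delta> \<and> card (core G) = r"

definition strong_central_two_tree :: "nat \<Rightarrow> nat \<Rightarrow> 'a pair_pre_digraph \<Rightarrow> bool" where
  "strong_central_two_tree r \<Delta> G \<longleftrightarrow>
     central_two_tree r \<Delta> G \<and> complete_digraph r (induce_subgraph (with_proj G) (core G))"

definition has_tail_set :: "'a pair_pre_digraph \<Rightarrow> nat set \<Rightarrow> bool" where
  "has_tail_set G S \<longleftrightarrow> (\<forall>v \<in> tail_verts G. deg G v \<in> S)"

text \<open>The spine \<open>ab\<close> of the book is \<open>01\<close>; the \<open>k\<close> further vertices are \<open>2, \<dots>, k + 1\<close>.\<close>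

definition book_graph :: "nat \<Rightarrow> nat pair_pre_digraph" where
  "book_graph k =
     \<lparr>pverts = {..<k + 2},
      parcs = {(0, 1), (1, 0)} \<union> (\<Union>i\<in>{2..<k + 2}. {(0, i), (i, 0), (1, i), (i, 1)})\<rparr>"

end

theory Submission
  imports Defs
begin

text \<open>
  A 2-tree on \<open>n\<close> vertices has \<open>2 n - 3\<close> edges, so the handshake identity of a bicentral 2-tree with
  tail degrees 2 and 3 reads \<open>2 \<Delta> + 2 (n - 2) + x = 4 n - 6\<close>, that is \<open>2 \<Delta> + x = 2 (n - 1)\<close>.  Hence
  \<open>x = 0\<close> iff \<open>\<Delta> = n - 1\<close>.  In that case each core vertex is adjacent to all others, and a tail vertex,
  having degree 2, is adjacent to the core vertices only: the graph is the book.
\<close>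

section \<open>Degrees, arc counts and the handshake identity\<close>

lemma deg_eq_card_Image: "deg G v = card (parcs G `` {v})"
proof -
  have "out_arcs (with_proj G) v = Pair v ` (parcs G `` {v})"
    by (auto simp: out_arcs_def)
  then show ?thesis
    by (simp add: out_degree_def card_image inj_on_def)
qed

text \<open>Each arc is counted at its tail. An edge is two arcs, so this is the handshake identity
  without a factor 2.\<close>

lemma (in pair_fin_digraph) sum_deg: "(\<Sum>v\<in>pverts G. deg G v) = card (parcs G)"
proof -
  have "parcs G = Sigma (pverts G) (\<lambda>v. parcs G `` {v})"
    by (auto dest: wellformed')
  moreover have "finite (parcs G `` {v})" for v
    using pair_finite_arcs by (simp add: finite_Image)
  ultimately show ?thesis
    using pair_finite_verts by (metis (no_types, lifting) card_SigmaI deg_eq_card_Image sum.cong)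
qed

text \<open>Attaching a vertex keeps the graph axioms: the new arcs come in opposite pairs, end in
  existing vertices, and are no loops because \<open>v\<close> is fresh.\<close>

lemma two_tree_pair_graph: "two_tree G \<Longrightarrow> pair_graph G"
proof (induction rule: two_tree.induct)
  case (triangle G)
  then show ?case by (simp add: complete_digraph_def pair_graphI_graph)
next
  case (add_vertex G a b v)
  interpret pair_graph G by (rule add_vertex.IH)
  have "a \<in> pverts G" "b \<in> pverts G"
    using add_vertex.hyps by (auto dest: wellformed')
  then show ?case
    using pair_finite_verts pair_finite_arcs pair_no_loops arcs_symmetric \<open>v \<notin> pverts G\<close>
    by unfold_locales (auto simp: symmetric_def sym_def dest: wellformed')
qed

text \<open>The triangle has 6 arcs on 3 vertices, and each attached vertex brings 4 new arcs. In
  edges this is \<open>2 n - 3\<close>; the 6 stands on the left to avoid truncated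
  subtraction.\<close>

lemma two_tree_card_arcs: "two_tree G \<Longrightarrow> card (parcs G) + 6 = 4 * card (pverts G)"
proof (induction rule: two_tree.induct)
  case (triangle G)
  then have V: "finite (pverts G)" "card (pverts G) = 3"
    and E: "parcs G = {(u, v). (u, v) \<in> pverts G \<times> pverts G \<and> u \<noteq> v}"
    by (simp_all add: complete_digraph_pair_def)
  have "parcs G = Sigma (pverts G) (\<lambda>u. pverts G - {u})"
    unfolding E by auto
  then show ?case using V by simp
next
  case (add_vertex G a b v)
  interpret pair_graph G using add_vertex.hyps by (simp add: two_tree_pair_graph)
  have "a \<noteq> b" "v \<noteq> a" "v \<noteq> b"
    using add_vertex.hyps pair_no_loops[of "(a, b)"] by (auto dest: wellformed')
  then have "card {(v, a), (a, v), (v, b), (b, v)} = 4"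
    by simp
  moreover have "parcs G \<inter> {(v, a), (a, v), (v, b), (b, v)} = {}"
    using \<open>v \<notin> pverts G\<close> by (auto dest: wellformed')
  ultimately have "card (parcs G \<union> {(v, a), (a, v), (v, b), (b, v)}) = card (parcs G) + 4"
    by (subst card_Un_disjoint) (simp_all add: pair_finite_arcs)
  then show ?case
    using add_vertex pair_finite_verts by simp
qed

lemma bicentral_tail_23_count:
  assumes G: "central_two_tree 2 \<Delta> G" and tail: "has_tail_set G {2, 3}"
  shows "2 * \<Delta> + card {v \<in> tail_verts G. deg G v = 3} + 2 = 2 * card (pverts G)"
proof -
  have T: "two_tree G" and C: "card (core G) = 2" and \<Delta>: "max_degree G = \<Delta>"
    using G by (auto simp: central_two_tree_def)
  interpret pair_graph G using T by (rule two_tree_pair_graph)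
  have sub: "core G \<subseteq> pverts G" by (auto simp: core_def)
  have fin: "finite (tail_verts G)" using pair_finite_verts by (simp add: tail_verts_def)
  \<comment> \<open>A tail degree is 2 plus the indicator of being 3, so the excess over 2 per tail
    vertex sums to \<open>x\<close>.\<close>
  have "(\<Sum>v\<in>tail_verts G. deg G v) = (\<Sum>v\<in>tail_verts G. 2 + (if deg G v = 3 then 1 else 0))"
    using tail by (intro sum.cong) (auto simp: has_tail_set_def)
  also have "\<dots> = 2 * card (tail_verts G) + card {v \<in> tail_verts G. deg G v = 3}"
    using fin by (simp add: sum.distrib sum.inter_filter[symmetric] del: add_2_eq_Suc)
  finally have "(\<Sum>v\<in>tail_verts G. deg G v) = \<dots>" .
  moreover have "(\<Sum>v\<in>core G. deg G v) = 2 * \<Delta>"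
    using C \<Delta> by (simp add: core_def)
  moreover have "(\<Sum>v\<in>pverts G. deg G v) = (\<Sum>v\<in>tail_verts G. deg G v) + (\<Sum>v\<in>core G. deg G v)"
    using sum.subset_diff[OF sub pair_finite_verts] by (simp add: tail_verts_def)
  moreover have "card (pverts G) = card (tail_verts G) + 2"
    using card_Diff_subset[OF _ sub] card_mono[OF pair_finite_verts sub] C
      finite_subset[OF sub pair_finite_verts]
    by (simp add: tail_verts_def)
  ultimately show ?thesis
    using sum_deg two_tree_card_arcs[OF T] by simp
qed

section \<open>Books: adjacency and recognition up to isomorphism\<close>

lemma pverts_book_graph [simp]: "pverts (book_graph k) = {..<k + 2}"
  by (simp add: book_graph_def)

text \<open>A book is the join of the spine edge with \<open>k\<close> isolated vertices; this
  symmetric form replaces the list of arcs from here on.\<close>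

lemma parcs_book_graph_iff:
  "(u, v) \<in> parcs (book_graph k) \<longleftrightarrow> u < k + 2 \<and> v < k + 2 \<and> u \<noteq> v \<and> (u < 2 \<or> v < 2)"
  by (auto simp: book_graph_def less_2_cases_iff)

text \<open>Adjacency of distinct vertices depends only on membership in \<open>C\<close>, so any
  bijection that sends \<open>C\<close> to the spine and the other vertices to the pages is an
  isomorphism.\<close>

lemma isomorphic_book_graphI:
  assumes "pair_graph G" and C: "C \<subseteq> pverts G" "card C = 2"
    and arcs: "\<And>u v. (u, v) \<in> parcs G \<longleftrightarrow>
      u \<in> pverts G \<and> v \<in> pverts G \<and> u \<noteq> v \<and> (u \<in> C \<or> v \<in> C)"
  shows "isomorphic G (book_graph (card (pverts G) - 2))"
proof -
  interpret pair_graph G by fact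
  let ?n = "card (pverts G)"
  have fin: "finite C" and n: "?n \<ge> 2"
    using finite_subset[OF C(1) pair_finite_verts] card_mono[OF pair_finite_verts C(1)] C(2)
    by simp_all
  obtain g where g: "bij_betw g C {..<2::nat}"
    using bij_betw_iff_card[of C "{..<2::nat}"] C fin by auto
  obtain h where h: "bij_betw h (pverts G - C) {2..<?n}"
    using bij_betw_iff_card[of "pverts G - C" "{2..<?n}"] C fin pair_finite_verts
    by (auto simp: card_Diff_subset)
  define f where "f v = (if v \<in> C then g v else h v)" for v
  have fC: "bij_betw f C {..<2}"
    using g by (subst bij_betw_cong[of C f g]) (auto simp: f_def)
  have fT: "bij_betw f (pverts G - C) {2..<?n}"
    using h by (subst bij_betw_cong[of _ f h]) (auto simp: f_def)
  have "bij_betw f (C \<union> (pverts G - C)) ({..<2} \<union> {2..<?n})"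
    using fC fT by (rule bij_betw_combine) auto
  moreover have "C \<union> (pverts G - C) = pverts G" "{..<2} \<union> {2..<?n} = {..<?n}"
    using C n by auto
  ultimately have f: "bij_betw f (pverts G) {..<?n}" by simp
  \<comment> \<open>This is all that adjacency in the book asks about \<open>f\<close>, apart from
    injectivity.\<close>
  have f2: "f v < 2 \<longleftrightarrow> v \<in> C" if "v \<in> pverts G" for v
    using bij_betwE[OF fC] bij_betwE[OF fT] that by (cases "v \<in> C") (auto dest!: bspec)
  have inj: "inj_on f (pverts G)" and img: "f ` pverts G = {..<?n}"
    using f by (auto simp: bij_betw_def)
  have "parcs (book_graph (?n - 2)) = map_prod f f ` parcs G"
  proof (intro set_eqI iffI)
    fix e assume e: "e \<in> parcs (book_graph (?n - 2))"
    obtain i j where ij: "e = (i, j)" by fastforce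
    have "i < ?n" "j < ?n" "i \<noteq> j" "i < 2 \<or> j < 2"
      using e n by (auto simp: ij parcs_book_graph_iff)
    then obtain u v where "u \<in> pverts G" "v \<in> pverts G" "i = f u" "j = f v"
      using img by (metis imageE lessThan_iff)
    then show "e \<in> map_prod f f ` parcs G"
      using \<open>i \<noteq> j\<close> \<open>i < 2 \<or> j < 2\<close> arcs f2 by (force simp: ij)
  next
    fix e assume "e \<in> map_prod f f ` parcs G"
    then obtain u v where uv: "e = (f u, f v)" "(u, v) \<in> parcs G" by auto
    then have "u \<in> pverts G" "v \<in> pverts G" "u \<noteq> v" "u \<in> C \<or> v \<in> C" using arcs by auto
    moreover from this have "f u < ?n" "f v < ?n" using img by auto
    ultimately show "e \<in> parcs (book_graph (?n - 2))"
      using uv(1) f2 n inj by (auto simp: parcs_book_graph_iff inj_on_eq_iff)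
  qed
  \<comment> \<open>A digraph isomorphism has a separate injective map on arcs; as arcs are pairs
    here, \<open>f\<close> induces it.\<close>
  moreover have "inj_on (map_prod f f) (parcs G)"
    by (rule inj_on_subset[OF map_prod_inj_on[OF inj inj]]) (auto dest: wellformed')
  ultimately show ?thesis
    unfolding isomorphic_def digraph_iso_def digraph_isomorphism_def
    using inj img n wf_digraph
    by (intro exI[of _ "\<lparr>iso_verts = f, iso_arcs = map_prod f f, iso_head = snd, iso_tail = fst\<rparr>"])
      (auto simp: app_iso_def with_proj_def)
qed

text \<open>An isomorphism is onto the vertices and preserves each degree, so both graphs have the
  same set of degrees. This yields the step from (iii) to (ii).\<close>

lemma isomorphic_max_degree:
  assumes "isomorphic G H"
  shows "max_degree H = max_degree G"
proof -
  obtain f where f: "pre_digraph.digraph_isomorphism (with_proj G) f"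
    and H: "with_proj H = app_iso f (with_proj G)"
    using assms by (auto simp: isomorphic_def digraph_iso_def)
  interpret wf_digraph "with_proj G" using f by (simp add: pre_digraph.digraph_isomorphism_def)
  have "pverts H = iso_verts f ` pverts G"
    using arg_cong[OF H, of verts] by simp
  moreover have "deg H (iso_verts f v) = deg G v" if "v \<in> pverts G" for v
    using f that by (simp add: H out_degree_app_iso_eq)
  ultimately have "deg H ` pverts H = deg G ` pverts G"
    by (simp add: image_image)
  then show ?thesis by (simp add: max_degree_def)
qed

section \<open>The book as a strong bicentral 2-tree, and its degree sequence\<close>

lemma deg_book_graph: "v < k + 2 \<Longrightarrow> deg (book_graph k) v = (if v < 2 then k + 1 else 2)"
proof -
  assume v: "v < k + 2"
  have "parcs (book_graph k) `` {v} = (if v < 2 then {..<k + 2} - {v} else {..<2})"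
    using v by (auto simp: parcs_book_graph_iff)
  then show ?thesis using v by (simp add: deg_eq_card_Image)
qed

lemma max_degree_book_graph: "k \<ge> 1 \<Longrightarrow> max_degree (book_graph k) = k + 1"
  unfolding max_degree_def
  by (rule Max_eqI) (auto simp: deg_book_graph split: if_splits intro!: rev_image_eqI[of 0])

text \<open>From \<open>k = 2\<close> on, the spine degree \<open>k + 1\<close> exceeds the page
  degree 2; for \<open>k = 1\<close> the book is a triangle and all three vertices are in the
  core.\<close>

lemma core_book_graph: "k \<ge> 2 \<Longrightarrow> core (book_graph k) = {..<2}"
  by (auto simp: core_def max_degree_book_graph deg_book_graph split: if_splits)

text \<open>The book with one page is the triangle, and every further page is a vertex attached to
  the spine edge.\<close>

lemma two_tree_book_graph: "k \<ge> 1 \<Longrightarrow> two_tree (book_graph k)"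
proof (induction k rule: dec_induct)
  case base
  have "complete_digraph 3 (with_proj (book_graph 1))"
    by (auto simp: complete_digraph_pair_def parcs_book_graph_iff)
  then show ?case by (rule two_tree.triangle)
next
  case (step k)
  have "book_graph (Suc k) = \<lparr>pverts = insert (k + 2) (pverts (book_graph k)),
      parcs = parcs (book_graph k) \<union> {(k + 2, 0), (0, k + 2), (k + 2, 1), (1, k + 2)}\<rparr>"
    by (rule pair_pre_digraph.equality)
      (auto simp: parcs_book_graph_iff less_2_cases_iff less_Suc_eq)
  moreover have "(0, 1) \<in> parcs (book_graph k)"
    by (simp add: parcs_book_graph_iff)
  ultimately show ?case
    using two_tree.add_vertex[OF step.IH, of 0 1 "k + 2"] by simp
qed

lemma strong_bicentral_book_graph:
  assumes "k \<ge> 2"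
  shows "strong_central_two_tree 2 (k + 1) (book_graph k)"
proof -
  have tt: "two_tree (book_graph k)" using assms by (intro two_tree_book_graph) simp
  interpret pair_graph "book_graph k" using tt by (rule two_tree_pair_graph)
  \<comment> \<open>Completeness of the core includes being a graph; the graph axioms, symmetry
    among them, pass to induced subgraphs.\<close>
  have ind: "induced_subgraph (with_proj (book_graph k) \<restriction> {..<2}) (with_proj (book_graph k))"
    by (rule induced_induce) auto
  interpret core: digraph "with_proj (book_graph k) \<restriction> {..<2}"
    using ind by (rule digraphI_induced)
  have "graph (with_proj (book_graph k) \<restriction> {..<2})"
    using induced_graph_imp_symmetric[OF pair_sym_arcs ind] by (rule core.graphI)
  moreover have "arcs_ends (with_proj (book_graph k) \<restriction> {..<2})
      = {(u, v). (u, v) \<in> {..<2} \<times> {..<2} \<and> u \<noteq> v}"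
    by (force simp: arcs_ends_conv parcs_book_graph_iff)
  ultimately show ?thesis
    using assms tt
    by (simp add: strong_central_two_tree_def central_two_tree_def complete_digraph_def
        core_book_graph max_degree_book_graph)
qed

lemma degree_sequence_book_graph:
  assumes "k \<ge> 1"
  shows "degree_sequence (book_graph k) = [k + 1, k + 1] @ replicate k 2"
proof -
  have "image_mset (deg (book_graph k)) (mset_set {..<k + 2})
      = image_mset (\<lambda>v. if v < 2 then k + 1 else 2) (mset [0..<k + 2])"
    by (simp only: mset_upt atLeast0LessThan) (rule image_mset_cong, simp add: deg_book_graph)
  also have "[0..<k + 2] = [0, 1] @ [2..<k + 2]"
    by (simp add: upt_conv_Cons numeral_2_eq_2)
  also have "image_mset (\<lambda>v. if v < 2 then k + 1 else 2) (mset ([0, 1] @ [2..<k + 2]))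
      = mset (replicate k 2 @ [k + 1, k + 1])"
  proof -
    have "map (\<lambda>v. if v < 2 then k + 1 else 2) [2..<k + 2] = map (\<lambda>_. 2) [2..<k + 2]"
      by (rule map_cong) auto
    also have "\<dots> = replicate k 2"
      by (simp add: map_replicate_const del: upt_Suc)
    finally have "map (\<lambda>v. if v < 2 then k + 1 else 2) [2..<k + 2] = replicate k 2" .
    then show ?thesis
      by (simp flip: mset_map)
  qed
  finally have "sorted_list_of_multiset (image_mset (deg (book_graph k)) (mset_set {..<k + 2}))
      = sort (replicate k 2 @ [k + 1, k + 1])"
    by (simp only: sorted_list_of_multiset_mset)
  \<comment> \<open>Since \<open>2 \<le> k + 1\<close>, the list with the pages first is already
    ascending; \<open>degree_sequence\<close> reverses it.\<close>
  also have "\<dots> = replicate k 2 @ [k + 1, k + 1]"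
    using assms by (intro sorted_sort_id) (auto simp: sorted_append)
  finally have "sorted_list_of_multiset (image_mset (deg (book_graph k)) (mset_set {..<k + 2}))
      = replicate k 2 @ [k + 1, k + 1]" .
  then show ?thesis
    by (simp add: degree_sequence_def)
qed

section \<open>Maximum degree \<open>n - 1\<close> forces the book; the equivalences and
  uniqueness\<close>

lemma isomorphic_book_graph_if_max_degree:
  assumes G: "central_two_tree 2 (card (pverts G) - 1) G" and tail: "has_tail_set G {2, 3}"
  shows "isomorphic G (book_graph (card (pverts G) - 2))"
proof -
  let ?V = "pverts G"
  have T: "two_tree G" and C: "card (core G) = 2" and \<Delta>: "max_degree G = card ?V - 1"
    using G by (auto simp: central_two_tree_def)
  interpret pair_graph G using T by (rule two_tree_pair_graph)
  have sub: "core G \<subseteq> ?V" by (auto simp: core_def)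
  have finT: "finite (tail_verts G)" using pair_finite_verts by (simp add: tail_verts_def)
  have n: "card ?V \<ge> 2" using card_mono[OF pair_finite_verts sub] C by simp
  \<comment> \<open>For \<open>\<Delta> = n - 1\<close> the counting identity leaves nothing for
    \<open>x\<close>.\<close>
  have "card {v \<in> tail_verts G. deg G v = 3} = 0"
    using bicentral_tail_23_count[OF G tail] n by simp
  then have deg2: "deg G v = 2" if "v \<in> tail_verts G" for v
    using that tail finT by (auto simp: has_tail_set_def)
  have core_nbrs: "parcs G `` {c} = ?V - {c}" if "c \<in> core G" for c
  proof (rule card_subset_eq)
    show "parcs G `` {c} \<subseteq> ?V - {c}"
      by (auto dest: wellformed' pair_no_loops)
    show "card (parcs G `` {c}) = card (?V - {c})"
      using that \<Delta> by (simp add: core_def deg_eq_card_Image)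
  qed (simp add: pair_finite_verts)
  \<comment> \<open>By symmetry a tail vertex is adjacent to both core vertices, and these exhaust
    its degree 2.\<close>
  have tail_nbrs: "parcs G `` {v} = core G" if "v \<in> tail_verts G" for v
  proof (rule sym, rule card_subset_eq)
    show "finite (parcs G `` {v})" using pair_finite_arcs by (simp add: finite_Image)
    show "core G \<subseteq> parcs G `` {v}"
      using core_nbrs that arcs_symmetric by (fastforce simp: tail_verts_def)
    show "card (core G) = card (parcs G `` {v})"
      using deg2[OF that] C by (simp add: deg_eq_card_Image)
  qed
  show ?thesis
  proof (rule isomorphic_book_graphI[OF pair_graph sub C])
    fix u v
    show "(u, v) \<in> parcs G \<longleftrightarrow> u \<in> ?V \<and> v \<in> ?V \<and> u \<noteq> v \<and> (u \<in> core G \<or> v \<in> core G)"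
    proof (cases "u \<in> core G")
      case True
      then show ?thesis using core_nbrs[OF True] sub by auto
    next
      case False
      then show ?thesis
        using tail_nbrs[of u] sub by (auto simp: tail_verts_def dest: wellformed')
    qed
  qed
qed

theorem theorem4p3:
  fixes n :: nat
  assumes "n \<ge> 4"
  shows
    "(\<forall>(G :: 'a pair_pre_digraph) (\<Delta> :: nat) (x :: nat).
        strong_central_two_tree 2 \<Delta> G \<and> card (pverts G) = n \<and> has_tail_set G {2, 3} \<and>
        x = card {v \<in> tail_verts G. deg G v = 3} \<longrightarrow>
          (x = 0 \<longleftrightarrow> \<Delta> = n - 1) \<and> (\<Delta> = n - 1 \<longleftrightarrow> isomorphic G (book_graph (n - 2)))) \<and>
     (\<exists>\<Delta>. strong_central_two_tree 2 \<Delta> (book_graph (n - 2))) \<and>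
     degree_sequence (book_graph (n - 2)) = [n - 1, n - 1] @ replicate (n - 2) 2 \<and>
     (\<forall>(H :: 'a pair_pre_digraph) (\<Delta> :: nat).
        strong_central_two_tree 2 \<Delta> H \<and>
        degree_sequence H = [n - 1, n - 1] @ replicate (n - 2) 2 \<longrightarrow>
          isomorphic H (book_graph (n - 2)))"
proof (intro conjI allI impI)
  fix G :: "'a pair_pre_digraph" and \<Delta> x :: nat
  assume *: "strong_central_two_tree 2 \<Delta> G \<and> card (pverts G) = n \<and> has_tail_set G {2, 3} \<and>
    x = card {v \<in> tail_verts G. deg G v = 3}"
  then have G: "central_two_tree 2 \<Delta> G"
    by (simp add: strong_central_two_tree_def)
  \<comment> \<open>Each of \<open>\<Delta>\<close> and \<open>x\<close> determines the other, which
    gives (i) iff (ii).\<close>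
  have "2 * \<Delta> + x + 2 = 2 * n"
    using bicentral_tail_23_count[OF G] * by simp
  then show "x = 0 \<longleftrightarrow> \<Delta> = n - 1"
    using assms by auto
  show "\<Delta> = n - 1 \<longleftrightarrow> isomorphic G (book_graph (n - 2))"
  proof
    assume "\<Delta> = n - 1"
    then show "isomorphic G (book_graph (n - 2))"
      using isomorphic_book_graph_if_max_degree G * by auto
  next
    assume "isomorphic G (book_graph (n - 2))"
    then show "\<Delta> = n - 1"
      using isomorphic_max_degree[of G "book_graph (n - 2)"] G assms
      by (simp add: max_degree_book_graph central_two_tree_def)
  qed
next
  show "\<exists>\<Delta>. strong_central_two_tree 2 \<Delta> (book_graph (n - 2))"
    \<comment> \<open>Unification finds the witness \<open>n - 2 + 1\<close>;
      \<open>n \<ge> 4\<close> provides the two pages that make the core exactly the spine.\<close>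
    by (rule exI, rule strong_bicentral_book_graph) (use assms in simp)
next
  show "degree_sequence (book_graph (n - 2)) = [n - 1, n - 1] @ replicate (n - 2) 2"
    using degree_sequence_book_graph[of "n - 2"] assms by (simp add: Suc_diff_le numeral_eq_Suc)
next
  fix H :: "'a pair_pre_digraph" and \<Delta> :: nat
  assume *: "strong_central_two_tree 2 \<Delta> H \<and>
    degree_sequence H = [n - 1, n - 1] @ replicate (n - 2) 2"
  then have H: "central_two_tree 2 \<Delta> H" and T: "two_tree H" and \<Delta>: "max_degree H = \<Delta>"
    by (simp_all add: strong_central_two_tree_def central_two_tree_def)
  interpret pair_graph H using T by (rule two_tree_pair_graph)
  \<comment> \<open>The order, the maximum degree and the tail set of \<open>H\<close> are to be
    recovered from the sequence; its multiset of entries suffices.\<close>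
  have "image_mset (deg H) (mset_set (pverts H)) = mset (degree_sequence H)"
    by (simp add: degree_sequence_def)
  also have "degree_sequence H = [n - 1, n - 1] @ replicate (n - 2) 2"
    using * by simp
  finally have degs: "image_mset (deg H) (mset_set (pverts H))
      = mset ([n - 1, n - 1] @ replicate (n - 2) 2)" .
  have card: "card (pverts H) = n"
    using arg_cong[OF degs, of size] assms by simp
  have img: "deg H ` pverts H = {n - 1, 2}"
    using arg_cong[OF degs, of set_mset] assms pair_finite_verts by auto
  then have "\<Delta> = n - 1"
    using assms \<Delta> by (simp add: max_degree_def)
  \<comment> \<open>A degree other than the maximum \<open>n - 1\<close> can only be 2.\<close>
  moreover have "has_tail_set H {2, 3}"
    using img \<Delta> \<open>\<Delta> = n - 1\<close> by (auto simp: has_tail_set_def tail_verts_def core_def)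
  ultimately show "isomorphic H (book_graph (n - 2))"
    using isomorphic_book_graph_if_max_degree[of H] H card by simp
qed

end
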